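(* Let $r\ge1$ be an integer and let $z_1,\ldots,z_r\in\mathbb C$ be roots of unity. For any $a_1,\ldots,a_r\in\mathbb Z$ and any non-negative integers $k_1,\ldots,k_r$, the sequence $(u_n)_{n>r}$ given by $$u_n:=\sum_{n>n_1>\cdots>n_r>0}\frac{z_1^{n_1}(\log n_1)^{k_1}\cdots z_r^{n_r}(\log n_r)^{k_r}}{n_1^{a_1}\cdots n_r^{a_r}}$$ has an asymptotic expansion to arbitrary precision relative to the comparison scale $\mathcal E$ with coefficients in $\mathcal C$.
   Context: $\mathbb N$ denotes the set of non-negative integers. $\mathcal E$ is the comparison scale formed by the sequences $\left((\log n)^l n^{-m}\right)_{n\ge1}$ with $l\in\mathbb N$, $m\in\mathbb Z$. $\mathcal C$ is the $\mathbb C$-algebra (of complex sequences, with termwise operations) generated by the constant sequence $(1)_{n\ge1}$ and the sequences $(z_i^n)_{n\ge1}$ for $1\le i\le r$. A complex sequence $(u_n)$ (defined for all large enough $n$) has an asymptotic expansion relative to $\mathcal E$ with coefficients in $\mathcal C$ to arbitrary precision if there is a family of sequences $\left((a_n^{(l,m)})_{n\ge1}\right)_{l\in\mathbb N,\,m\in\mathbb Z}$ in $\mathcal C$ such that: for $m$ sufficiently small (i.e. all $m$ below some bound) these sequences are zero for all $l$; for each $m$ they are zero for all but finitely many $l$; and for every integer $A$, $$u_n=\sum_{l\ge0,\ m\le A}a_n^{(l,m)}(\log n)^l n^{-m}+o(n^{-A})\quad\text{as } n\to\infty.$$ *)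

theory Defs
  imports Complex_Main "HOL-Library.FuncSet" "HOL-Library.Landau_Symbols"
begin

text \<open>
  Sequences indexed by \<open>n \<ge> 1\<close> are functions on \<^typ>\<open>nat\<close> whose value at \<open>0\<close> plays no role.
\<close>

inductive_set generated_algebra :: "(nat \<Rightarrow> complex) set \<Rightarrow> (nat \<Rightarrow> complex) set"
  for G :: "(nat \<Rightarrow> complex) set"
where
  one: "(\<lambda>n. 1) \<in> generated_algebra G"
| gen: "g \<in> G \<Longrightarrow> g \<in> generated_algebra G"
| scale: "f \<in> generated_algebra G \<Longrightarrow> (\<lambda>n. c * f n) \<in> generated_algebra G"
| add: "f \<in> generated_algebra G \<Longrightarrow> g \<in> generated_algebra G \<Longrightarrow>
    (\<lambda>n. f n + g n) \<in> generated_algebra G"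
| mult: "f \<in> generated_algebra G \<Longrightarrow> g \<in> generated_algebra G \<Longrightarrow>
    (\<lambda>n. f n * g n) \<in> generated_algebra G"

definition coeff_algebra :: "nat \<Rightarrow> (nat \<Rightarrow> complex) \<Rightarrow> (nat \<Rightarrow> complex) set" where
  "coeff_algebra r z = generated_algebra ((\<lambda>i n. z i ^ n) ` {1..r})"

definition log_scale :: "nat \<Rightarrow> int \<Rightarrow> nat \<Rightarrow> complex" where
  "log_scale l m n = of_real (ln (real n)) ^ l * of_nat n powi (- m)"

definition coeff_support :: "(nat \<Rightarrow> int \<Rightarrow> nat \<Rightarrow> complex) \<Rightarrow> (nat \<times> int) set" where
  "coeff_support a = {(l, m). \<exists>n\<ge>1. a l m n \<noteq> 0}"

text \<open>
  The sum over all \<open>l \<ge> 0\<close> and \<open>m \<le> A\<close> is restricted to the indices of the nonzero coefficient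
  sequences, because \<^const>\<open>sum\<close> vanishes on infinite index sets. The two support
  conditions make the restricted index set finite, see \<open>finite_coeff_support_le\<close> below.
\<close>

definition has_asymptotic_expansion :: "(nat \<Rightarrow> complex) set \<Rightarrow> (nat \<Rightarrow> complex) \<Rightarrow> bool" where
  "has_asymptotic_expansion C u \<longleftrightarrow>
    (\<exists>a :: nat \<Rightarrow> int \<Rightarrow> nat \<Rightarrow> complex.
      (\<forall>l m. a l m \<in> C) \<and>
      (\<exists>M. \<forall>m<M. \<forall>l. (l, m) \<notin> coeff_support a) \<and>
      (\<forall>m. finite {l. (l, m) \<in> coeff_support a}) \<and>
      (\<forall>A :: int.
        (\<lambda>n. u n - (\<Sum>(l, m) \<in> {(l, m) \<in> coeff_support a. m \<le> A}. a l m n * log_scale l m n))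
          \<in> o(\<lambda>n. of_nat n powi (- A))))"

lemma finite_coeff_support_le:
  assumes "\<forall>m<M. \<forall>l. (l, m) \<notin> coeff_support a"
    and "\<forall>m. finite {l. (l, m) \<in> coeff_support a}"
  shows "finite {(l, m) \<in> coeff_support a. m \<le> A}"
proof (rule finite_subset)
  show "{(l, m) \<in> coeff_support a. m \<le> A}
      \<subseteq> (\<Union>m\<in>{M..A}. {l. (l, m) \<in> coeff_support a} \<times> {m})"
    using assms(1) by (fastforce simp: not_less)
  show "finite (\<Union>m\<in>{M..A}. {l. (l, m) \<in> coeff_support a} \<times> {m})"
    using assms(2) by auto
qed

definition decreasing_tuples :: "nat \<Rightarrow> nat \<Rightarrow> (nat \<Rightarrow> nat) set" where
  "decreasing_tuples r n = {\<nu> \<in> {1..r} \<rightarrow>\<^sub>E {0<..<n}. \<forall>i\<in>{1..<r}. \<nu> i > \<nu> (Suc i)}"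

definition nested_sum ::
  "nat \<Rightarrow> (nat \<Rightarrow> complex) \<Rightarrow> (nat \<Rightarrow> int) \<Rightarrow> (nat \<Rightarrow> nat) \<Rightarrow> nat \<Rightarrow> complex" where
  "nested_sum r z a k n =
    (\<Sum>\<nu> \<in> decreasing_tuples r n.
      \<Prod>i=1..r. z i ^ \<nu> i * of_real (ln (real (\<nu> i))) ^ k i / of_nat (\<nu> i) powi a i)"

end

(*
  Call u expandable of order s if it has an expansion into terms w^n (log n)^l n^(-m) with m >= s,
  where w ranges over a multiplicative set W of numbers of modulus 1; this is a coinductive notion:
  subtracting a suitable combination of terms of order s leaves a sequence expandable of order s + 1.
  Multiplication by w^n (log n)^k n^(-a) preserves expandability, so the theorem follows by induction
  on r once partial sums of expandable sequences are expandable.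
  Each term of order s + 1 is, up to something expandable of order s + 2, the difference of a
  combination of terms of orders s and s + 1: for w = 1 take a primitive of (log x)^l x^(-s-1), for
  w <> 1 divide by w - 1, and control the error by Taylor expansion in both cases. Iterating this
  yields the expansion of the partial sums; the one constant of summation enters at order 0, as
  antidifferences of sequences of order at least 2 converge.
*)

theory Submission
  imports Defs "HOL-Analysis.Analysis" "HOL-Computational_Algebra.Polynomial"
begin

section \<open>Polynomials in the logarithm times a power\<close>

text \<open>Real-variable form of the comparison scale, so that derivatives and Taylor's formula are
  available. One polynomial gathers all powers of the logarithm attached to the same power of
  \<open>x\<close>, a family closed under differentiation.\<close>

definition log_poly :: "real poly \<Rightarrow> int \<Rightarrow> real \<Rightarrow> real" where
  "log_poly P m x = poly P (ln x) * x powr (- of_int m)"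

text \<open>Differentiation of P(log x) x^(-m), read off on P: the chain rule contributes P', the
  power contributes -m P, and the exponent of x drops by one.\<close>

definition log_poly_deriv :: "int \<Rightarrow> real poly \<Rightarrow> real poly" where
  "log_poly_deriv m P = pderiv P - smult (of_int m) P"

text \<open>The operator depends on the current exponent, which has become m + i after i
  derivatives; hence it is not a plain iterate.\<close>

primrec iter_log_poly_deriv :: "int \<Rightarrow> real poly \<Rightarrow> nat \<Rightarrow> real poly" where
  "iter_log_poly_deriv m P 0 = P"
| "iter_log_poly_deriv m P (Suc i) = log_poly_deriv (m + int i) (iter_log_poly_deriv m P i)"

lemma DERIV_log_poly:
  assumes "x > 0"
  shows "(log_poly P m has_real_derivative log_poly (log_poly_deriv m P) (m + 1) x) (at x)"
proof -
  have "((\<lambda>x. poly P (ln x)) has_real_derivative poly (pderiv P) (ln x) * (1 / x)) (at x)"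
    using DERIV_chain2[OF poly_DERIV DERIV_ln_divide[OF assms]] .
  moreover have "((\<lambda>x. x powr (- of_int m)) has_real_derivative
      (- of_int m) * x powr (- of_int m - 1)) (at x)"
    using has_real_derivative_powr[OF assms] .
  ultimately have "((\<lambda>x. poly P (ln x) * x powr (- of_int m)) has_real_derivative
      poly (pderiv P) (ln x) * (1 / x) * x powr (- of_int m)
      + (- of_int m) * x powr (- of_int m - 1) * poly P (ln x)) (at x)"
    by (rule DERIV_mult)
  then have "(log_poly P m has_real_derivative
      poly (pderiv P) (ln x) * (1 / x) * x powr (- of_int m)
      + (- of_int m) * x powr (- of_int m - 1) * poly P (ln x)) (at x)"
    by (simp add: log_poly_def[abs_def])
  moreover define y where "y = x powr (- of_int m - 1)"
  moreover have "x powr (- of_int m) = y * x"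
    using powr_add[of x "- of_int m - 1" 1] assms by (simp add: y_def)
  moreover have "x powr (- of_int (m + 1)) = y" by (simp add: y_def)
  ultimately show ?thesis
    using assms unfolding log_poly_def[of _ "m + 1"] log_poly_deriv_def
    by (elim DERIV_cong) (simp add: algebra_simps)
qed

lemma log_poly_deriv_smult: "log_poly_deriv m (smult c P) = smult c (log_poly_deriv m P)"
  by (simp add: log_poly_deriv_def pderiv_smult smult_diff_right mult.commute)

lemma log_poly_deriv_diff: "log_poly_deriv m (P - Q) = log_poly_deriv m P - log_poly_deriv m Q"
  by (simp add: log_poly_deriv_def pderiv_diff smult_diff_right)

lemma ln_bigo_powr:
  fixes e :: real
  assumes "e > 0"
  shows "(\<lambda>x. ln x) \<in> O(\<lambda>x. x powr e)"
proof (rule landau_o.bigI)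
  show "1 / e > 0" using assms by simp
  show "\<forall>\<^sub>F x in at_top. norm (ln x) \<le> 1 / e * norm (x powr e)"
    using eventually_ge_at_top[of 1]
    by eventually_elim (use ln_powr_bound[OF _ assms] in auto)
qed

lemma poly_ln_bigo_powr:
  fixes e :: real
  assumes "e > 0"
  shows "(\<lambda>x. poly P (ln x)) \<in> O(\<lambda>x. x powr e)"
  using assms
proof (induction P arbitrary: e)
  case 0
  then show ?case by simp
next
  case (pCons a P)
  \<comment> \<open>Horner form: half of the exponent pays for the extra logarithm, the other half
    for the remaining polynomial.\<close>
  have "(\<lambda>x. ln x * poly P (ln x)) \<in> O(\<lambda>x. x powr (e/2) * x powr (e/2))"
    using pCons by (intro landau_o.big.mult ln_bigo_powr) auto
  moreover have "(\<lambda>_. a) \<in> O(\<lambda>x::real. x powr e)"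
  proof (rule landau_o.bigI)
    show "\<bar>a\<bar> + 1 > 0" by simp
    show "\<forall>\<^sub>F x in at_top. norm a \<le> (\<bar>a\<bar> + 1) * norm (x powr e)"
      using eventually_ge_at_top[of 1]
    proof eventually_elim
      case (elim x)
      then have "1 \<le> x powr e"
        using pCons.prems by (simp add: ge_one_powr_ge_zero)
      then show ?case
        using mult_mono[of "\<bar>a\<bar>" "\<bar>a\<bar> + 1" 1 "x powr e"] by simp
    qed
  qed
  ultimately show ?case
    by (simp add: powr_add[symmetric] sum_in_bigo)
qed

lemma log_poly_bigo:
  assumes "e > 0"
  shows "log_poly P m \<in> O(\<lambda>x. x powr (e - of_int m))"
proof -
  have "(\<lambda>x. poly P (ln x) * x powr (- of_int m)) \<in> O(\<lambda>x. x powr e * x powr (- of_int m))"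
    by (intro landau_o.big.mult poly_ln_bigo_powr assms) auto
  then show ?thesis
    by (simp add: log_poly_def[abs_def] powr_add[symmetric])
qed

text \<open>Solving P' - m P = X^l amounts to finding a primitive of (log x)^l x^(-m-1) of the same
  shape. For m = 0 the power of the logarithm rises by one; for m \<noteq> 0 repeated integration by
  parts terminates.\<close>

lemma log_poly_ode_monom: "\<exists>P. log_poly_deriv m P = monom 1 l"
proof (cases "m = 0")
  case True
  then have "log_poly_deriv m (monom (1 / real (Suc l)) (Suc l)) = monom 1 l"
    by (simp add: log_poly_deriv_def pderiv_monom del: of_nat_Suc)
  then show ?thesis by blast
next
  case False
  show ?thesis
  proof (induction l)
    case 0
    have "log_poly_deriv m [:- 1 / of_int m:] = monom 1 0"
      using False by (simp add: log_poly_deriv_def pderiv_pCons monom_0)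
    then show ?case by blast
  next
    case (Suc l)
    then obtain P where P: "log_poly_deriv m P = monom 1 l" by blast
    \<comment> \<open>The operator sends X^(l+1) to (l+1) X^l - m X^(l+1). Subtracting (l+1) P
      cancels the first summand, and the factor -1/m normalizes the second.\<close>
    let ?Q = "smult (- 1 / of_int m) (monom 1 (Suc l) - smult (real (Suc l)) P)"
    have "log_poly_deriv m ?Q = smult (- 1 / of_int m)
        (log_poly_deriv m (monom 1 (Suc l)) - smult (real (Suc l)) (log_poly_deriv m P))"
      by (simp only: log_poly_deriv_smult log_poly_deriv_diff)
    also have "\<dots> = monom 1 (Suc l)"
      using False unfolding P by (simp add: log_poly_deriv_def pderiv_monom smult_monom minus_monom del: of_nat_Suc)
    finally show ?case by blast
  qed
qed

section \<open>Taylor expansion over a unit step\<close>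

lemma log_poly_taylor:
  assumes "x > 0" "k > 0"
  shows "\<exists>t. x < t \<and> t < x + 1 \<and>
    log_poly P m (x + 1) = (\<Sum>i<k. log_poly (iter_log_poly_deriv m P i) (m + int i) x / fact i)
      + log_poly (iter_log_poly_deriv m P k) (m + int k) t / fact k"
proof -
  let ?d = "\<lambda>i. log_poly (iter_log_poly_deriv m P i) (m + int i)"
  have "\<forall>i t. i < k \<and> x \<le> t \<and> t \<le> x + 1 \<longrightarrow> (?d i has_real_derivative ?d (Suc i) t) (at t)"
  proof (intro allI impI)
    fix i t assume "i < k \<and> x \<le> t \<and> t \<le> x + 1"
    then show "(?d i has_real_derivative ?d (Suc i) t) (at t)"
      using DERIV_log_poly[of t "iter_log_poly_deriv m P i" "m + int i"] assms
      by (simp add: algebra_simps)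
  qed
  then show ?thesis
    using Taylor_up[of k ?d "log_poly P m" x "x + 1" x] assms by auto
qed

text \<open>The Lagrange remainder is a k-th derivative at a point between n and n + 1, so it has
  the size of that derivative at n up to a constant.\<close>

lemma log_poly_taylor_bigo:
  assumes "k > 0" "e > 0"
  shows "(\<lambda>n. log_poly P m (real n + 1)
      - (\<Sum>i<k. log_poly (iter_log_poly_deriv m P i) (m + int i) (real n) / fact i))
    \<in> O(\<lambda>n. real n powr (e - of_int (m + int k)))"
proof -
  let ?F = "log_poly (iter_log_poly_deriv m P k) (m + int k)"
  define d where "d = e - of_int (m + int k)"
  from log_poly_bigo[OF assms(2), of "iter_log_poly_deriv m P k" "m + int k"]
  obtain c where c: "c > 0" and ev: "\<forall>\<^sub>F x in at_top. norm (?F x) \<le> c * norm (x powr d)"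
    unfolding d_def by (elim landau_o.bigE)
  then obtain X where X: "\<And>x. x \<ge> X \<Longrightarrow> \<bar>?F x\<bar> \<le> c * x powr d"
    by (auto simp: eventually_at_top_linorder)
  have "\<forall>\<^sub>F n in sequentially. real n \<ge> max 1 X"
    by (rule eventually_sequentiallyI[of "nat \<lceil>max 1 X\<rceil>"]) linarith
  then have "\<forall>\<^sub>F n in sequentially. norm (log_poly P m (real n + 1)
      - (\<Sum>i<k. log_poly (iter_log_poly_deriv m P i) (m + int i) (real n) / fact i))
      \<le> (c * 2 powr \<bar>d\<bar>) * norm (real n powr d)"
  proof eventually_elim
    case (elim n)
    then have n: "real n \<ge> 1" "real n \<ge> X" by auto
    obtain t where t: "real n < t" "t < real n + 1" and eq:
      "log_poly P m (real n + 1) = (\<Sum>i<k. log_poly (iter_log_poly_deriv m P i) (m + int i) (real n) / fact i)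
      + ?F t / fact k"
      using log_poly_taylor[of "real n" k P m] n assms by auto
    \<comment> \<open>The exponent d may have either sign. Since 1 < t/n \<le> 2, passing to the
      absolute value of d covers both cases.\<close>
    have "(t / real n) powr d \<le> (t / real n) powr \<bar>d\<bar>"
      using t n by (intro powr_mono) auto
    also have "\<dots> \<le> 2 powr \<bar>d\<bar>"
      using t n by (intro powr_mono2) (auto simp: field_simps)
    finally have "t powr d \<le> 2 powr \<bar>d\<bar> * real n powr d"
      using t n by (simp add: powr_divide field_simps)
    then have "\<bar>?F t\<bar> \<le> c * (2 powr \<bar>d\<bar> * real n powr d)"
      using X[of t] t n c by (smt (verit) mult_left_mono)
    moreover have "\<bar>?F t / fact k\<bar> \<le> \<bar>?F t\<bar>"
      by (simp add: divide_le_eq mult_le_cancel_left1 fact_ge_1)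
    ultimately show ?case
      unfolding eq by (simp add: mult.assoc)
  qed
  then show ?thesis
    unfolding d_def by (rule landau_o.bigI[rotated]) (use c in auto)
qed


section \<open>Growth orders and coinductive expansions\<close>

text \<open>The loss of \<open>n powr e\<close> absorbs all powers of the logarithm.\<close>

definition growth_order :: "int \<Rightarrow> (nat \<Rightarrow> complex) \<Rightarrow> bool" where
  "growth_order s u \<longleftrightarrow> (\<forall>e>0. (\<lambda>n. norm (u n)) \<in> O(\<lambda>n. real n powr (e - of_int s)))"

lemma growth_order_cong:
  assumes "growth_order s u" "\<forall>\<^sub>F n in sequentially. u n = v n"
  shows "growth_order s v"
  unfolding growth_order_def
proof (intro allI impI)
  fix e :: real assume "e > 0"
  then have "(\<lambda>n. norm (u n)) \<in> O(\<lambda>n. real n powr (e - of_int s))"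
    using assms(1) by (simp add: growth_order_def)
  moreover have "\<forall>\<^sub>F n in sequentially. norm (u n) = norm (v n)"
    using assms(2) by eventually_elim simp
  ultimately show "(\<lambda>n. norm (v n)) \<in> O(\<lambda>n. real n powr (e - of_int s))"
    by (simp add: landau_o.big.in_cong)
qed

lemma growth_order_add:
  assumes "growth_order s u" "growth_order s v"
  shows "growth_order s (\<lambda>n. u n + v n)"
  unfolding growth_order_def
proof (intro allI impI)
  fix e :: real assume "e > 0"
  then have "(\<lambda>n. norm (u n) + norm (v n)) \<in> O(\<lambda>n. real n powr (e - of_int s))"
    using assms by (intro sum_in_bigo) (simp_all add: growth_order_def)
  moreover have "(\<lambda>n. norm (u n + v n)) \<in> O(\<lambda>n. norm (u n) + norm (v n))"
    by (intro landau_o.bigI[of 1] always_eventually) (auto intro: norm_triangle_ineq)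
  ultimately show "(\<lambda>n. norm (u n + v n)) \<in> O(\<lambda>n. real n powr (e - of_int s))"
    by (rule landau_o.big_trans[rotated])
qed

lemma growth_order_mult:
  assumes "growth_order s u" "growth_order m v"
  shows "growth_order (s + m) (\<lambda>n. u n * v n)"
  unfolding growth_order_def
proof (intro allI impI)
  fix e :: real assume "e > 0"
  then have "(\<lambda>n. norm (u n) * norm (v n))
      \<in> O(\<lambda>n. real n powr (e / 2 - of_int s) * real n powr (e / 2 - of_int m))"
    using assms by (intro landau_o.big.mult) (simp_all add: growth_order_def)
  then show "(\<lambda>n. norm (u n * v n)) \<in> O(\<lambda>n. real n powr (e - of_int (s + m)))"
    by (simp add: norm_mult powr_add[symmetric] algebra_simps)
qed

lemma growth_order_mono:
  assumes "growth_order s u" "s' \<le> s"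
  shows "growth_order s' u"
  unfolding growth_order_def
proof (intro allI impI)
  fix e :: real assume "e > 0"
  then have "(\<lambda>n. norm (u n)) \<in> O(\<lambda>n. real n powr (e - of_int s))"
    using assms(1) by (simp add: growth_order_def)
  moreover have "(\<lambda>n. real n powr (e - of_int s)) \<in> O(\<lambda>n. real n powr (e - of_int s'))"
  proof (rule landau_o.bigI[of 1])
    show "\<forall>\<^sub>F n in sequentially. norm (real n powr (e - of_int s))
        \<le> 1 * norm (real n powr (e - of_int s'))"
      using eventually_ge_at_top[of "1::nat"]
      by eventually_elim (use assms(2) in \<open>auto intro: powr_mono\<close>)
  qed simp
  ultimately show "(\<lambda>n. norm (u n)) \<in> O(\<lambda>n. real n powr (e - of_int s'))"
    by (rule landau_o.big_trans)
qed

lemma growth_order_unit_powers: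
  assumes "norm w = 1"
    and "\<And>e. e > 0 \<Longrightarrow> f \<in> O(\<lambda>n. real n powr (e - of_int s))"
  shows "growth_order s (\<lambda>n. c * w ^ n * complex_of_real (f n))"
  using assms unfolding growth_order_def by (simp add: norm_mult norm_power)

lemma growth_order_log_poly:
  assumes "norm w = 1"
  shows "growth_order s (\<lambda>n. c * w ^ n * complex_of_real (log_poly P s (real n)))"
  by (intro growth_order_unit_powers assms
        landau_o.big.compose[OF log_poly_bigo filterlim_real_sequentially])

lemma log_scale_eq_log_poly:
  assumes "n \<ge> 1"
  shows "log_scale l m n = complex_of_real (log_poly (monom 1 l) m (real n))"
proof -
  have "real n powr (- of_int m) = real n powi (- m)"
    using assms powr_real_of_int'[of "real n" "- m"] by simp
  then show ?thesis
    by (simp add: log_scale_def log_poly_def poly_monom)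
qed

lemma log_scale_mult:
  assumes "n \<ge> 1"
  shows "log_scale l m n * log_scale l' m' n = log_scale (l + l') (m + m') n"
proof -
  have "(of_nat n :: complex) powi (- (m + m')) = of_nat n powi (- m) * of_nat n powi (- m')"
    using power_int_add[of "of_nat n :: complex" "- m" "- m'"] assms by simp
  then show ?thesis
    by (simp add: log_scale_def power_add)
qed

section \<open>Sequences controlled by their differences\<close>

lemma bigo_tendsto_zero:
  fixes f g :: "'a \<Rightarrow> real"
  assumes "f \<in> O[F](g)" "(g \<longlongrightarrow> 0) F"
  shows "(f \<longlongrightarrow> 0) F"
proof -
  have "g \<in> o[F](\<lambda>_. 1)" using assms(2) by (simp add: smalloI_tendsto)
  then have "f \<in> o[F](\<lambda>_. 1)" using assms(1) landau_o.big_small_trans by blast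
  from smalloD_tendsto[OF this] show ?thesis by simp
qed

lemma growth_order_tendsto_zero:
  assumes "growth_order s u" "s \<ge> 1"
  shows "u \<longlonglongrightarrow> 0"
proof -
  have "(\<lambda>n. norm (u n)) \<in> O(\<lambda>n. real n powr (1 / 2 - of_int 1))"
    using growth_order_mono[OF assms] unfolding growth_order_def
    by (elim allE[of _ "1 / 2"]) simp
  moreover have "(\<lambda>n. real n powr (1 / 2 - of_int 1)) \<longlonglongrightarrow> 0"
    by (rule tendsto_neg_powr[OF _ filterlim_real_sequentially]) simp
  ultimately have "(\<lambda>n. norm (u n)) \<longlonglongrightarrow> 0"
    by (rule bigo_tendsto_zero)
  then show ?thesis by (rule tendsto_norm_zero_cancel)
qed

text \<open>By the triangle inequality the step bound makes |V| - g increasing from N on; its limit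
  is 0, so it is never positive there.\<close>

lemma norm_le_of_telescoping:
  fixes V :: "nat \<Rightarrow> complex" and g :: "nat \<Rightarrow> real"
  assumes "V \<longlonglongrightarrow> 0" "g \<longlonglongrightarrow> 0"
    and step: "\<And>n. n \<ge> N \<Longrightarrow> norm (V (Suc n) - V n) \<le> g n - g (Suc n)"
    and "n \<ge> N"
  shows "norm (V n) \<le> g n"
proof -
  let ?X = "\<lambda>k. norm (V (k + n)) - g (k + n)"
  have "incseq ?X"
  proof (rule incseq_SucI)
    fix k
    have "norm (V (k + n)) \<le> norm (V (Suc (k + n))) + norm (V (Suc (k + n)) - V (k + n))"
      by (metis add.commute norm_minus_commute norm_triangle_sub)
    then show "?X k \<le> ?X (Suc k)"
      using step[of "k + n"] assms(4) by simp
  qed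
  moreover have "?X \<longlonglongrightarrow> norm (0::complex) - 0"
    using assms(1,2) by (intro tendsto_diff tendsto_norm LIMSEQ_ignore_initial_segment)
  ultimately have "?X 0 \<le> norm (0::complex) - 0"
    by (rule incseq_le)
  then show ?thesis by simp
qed

text \<open>Mean value theorem for x^(-p) on [n, n + 1]. The intermediate point is at most 2n, which
  produces the factor 2^(-p-1).\<close>

lemma powr_telescope_le:
  fixes p :: real
  assumes "p > 0" "n \<ge> 1"
  shows "p * 2 powr (- p - 1) * real n powr (- p - 1) \<le> real n powr (- p) - real (Suc n) powr (- p)"
proof -
  have "\<exists>z. real n < z \<and> z < real (Suc n) \<and> real (Suc n) powr (- p) - real n powr (- p)
      = (real (Suc n) - real n) * ((- p) * z powr (- p - 1))"
  proof (rule MVT2)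
    fix x assume "real n \<le> x"
    then show "((\<lambda>x. x powr (- p)) has_real_derivative (- p) * x powr (- p - 1)) (at x)"
      using assms by (intro has_real_derivative_powr) auto
  qed simp
  then obtain z where z: "real n < z" "z < real (Suc n)"
    "real (Suc n) powr (- p) - real n powr (- p) = - p * z powr (- p - 1)"
    by auto
  have "(2 * real n) powr (- p - 1) \<le> z powr (- p - 1)"
    using z assms by (intro powr_mono2') auto
  then have "p * (2 powr (- p - 1) * real n powr (- p - 1)) \<le> p * z powr (- p - 1)"
    using assms by (simp add: powr_mult)
  then show ?thesis using z(3) by (simp add: mult.assoc)
qed

text \<open>Discrete integration from infinity: the differences are dominated by those of a multiple
  of n^(-p), and both sequences vanish at infinity, so the bound passes to V itself.\<close>

lemma growth_order_antidifference:
  assumes V: "V \<longlonglongrightarrow> 0" and d: "growth_order (s + 1) d" and "s \<ge> 1"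
    and ev: "\<forall>\<^sub>F n in sequentially. V (Suc n) - V n = d n"
  shows "growth_order s V"
  unfolding growth_order_def
proof (intro allI impI)
  fix e :: real assume e: "e > 0"
  \<comment> \<open>Capping the loss at 1/2 keeps p positive already for s = 1, so that n^(-p) tends
    to 0.\<close>
  define e' where "e' = min e (1 / 2)"
  define p where "p = of_int s - e'"
  have p: "p > 0" and e': "e' > 0"
    using \<open>s \<ge> 1\<close> e by (auto simp: p_def e'_def min_def)
  have "(\<lambda>n. norm (d n)) \<in> O(\<lambda>n. real n powr (e' - of_int (s + 1)))"
    using d e' by (simp add: growth_order_def)
  also have "e' - of_int (s + 1) = - p - 1" by (simp add: p_def)
  finally obtain c where c: "c > 0"
    "\<forall>\<^sub>F n in sequentially. norm (norm (d n)) \<le> c * norm (real n powr (- p - 1))"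
    by (elim landau_o.bigE)
  \<comment> \<open>K is chosen so that K times the lower bound of \<open>powr_telescope_le\<close>
    is exactly c n^(-p-1).\<close>
  define K where "K = c / (p * 2 powr (- p - 1))"
  have K: "K > 0" "K * (p * 2 powr (- p - 1)) = c"
    using c p by (auto simp: K_def)
  let ?g = "\<lambda>n. K * real n powr (- p)"
  have "\<forall>\<^sub>F n in sequentially. norm (V (Suc n) - V n) \<le> ?g n - ?g (Suc n)"
    using ev c(2) eventually_ge_at_top[of "1::nat"]
  proof eventually_elim
    case (elim n)
    have "K * (p * 2 powr (- p - 1) * real n powr (- p - 1))
        \<le> K * (real n powr (- p) - real (Suc n) powr (- p))"
      using K by (intro mult_left_mono powr_telescope_le p elim) auto
    moreover have "K * (p * 2 powr (- p - 1) * real n powr (- p - 1)) = c * real n powr (- p - 1)"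
      unfolding K(2)[symmetric] by simp
    ultimately show ?case
      using elim by (simp add: right_diff_distrib)
  qed
  then obtain N where N: "\<And>n. n \<ge> N \<Longrightarrow> norm (V (Suc n) - V n) \<le> ?g n - ?g (Suc n)"
    by (auto simp: eventually_at_top_linorder)
  have "?g \<longlonglongrightarrow> 0"
    using p by (intro tendsto_mult_right_zero tendsto_neg_powr[OF _ filterlim_real_sequentially]) auto
  have le: "norm (V n) \<le> ?g n" if "n \<ge> N" for n
    by (rule norm_le_of_telescoping[OF V \<open>?g \<longlonglongrightarrow> 0\<close> N that])
  show "(\<lambda>n. norm (V n)) \<in> O(\<lambda>n. real n powr (e - of_int s))"
  proof (rule landau_o.bigI[OF K(1)])
    show "\<forall>\<^sub>F n in sequentially. norm (norm (V n)) \<le> K * norm (real n powr (e - of_int s))"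
      using eventually_ge_at_top[of "max 1 N"]
    proof eventually_elim
      case (elim n)
      have "real n powr (- p) \<le> real n powr (e - of_int s)"
        using elim by (intro powr_mono) (auto simp: p_def e'_def)
      then have "?g n \<le> K * real n powr (e - of_int s)"
        using K by (intro mult_left_mono) auto
      with le[of n] elim show ?case by simp
    qed
  qed
qed

text \<open>Order 2 with loss 1/2 gives O(n^(-3/2)). The differences are therefore absolutely
  summable, and V is their partial sum up to a constant.\<close>

lemma growth_order_antidifference_convergent:
  assumes d: "growth_order 2 d"
    and ev: "\<forall>\<^sub>F n in sequentially. V (Suc n) - V n = d n"
  shows "convergent V"
proof -
  have "(\<lambda>n. norm (d n)) \<in> O(\<lambda>n. real n powr (1 / 2 - of_int 2))"
    using d unfolding growth_order_def by (elim allE[of _ "1 / 2"]) simp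
  moreover have "summable (\<lambda>n. norm (real n powr (1 / 2 - of_int 2)))"
    by (simp add: summable_real_powr_iff)
  ultimately have "summable (\<lambda>n. norm (d n))"
    by (rule summable_comparison_test_bigo[rotated])
  then have "summable d" by (rule summable_norm_cancel)
  moreover have "summable d \<longleftrightarrow> summable (\<lambda>n. V (Suc n) - V n)"
    by (rule summable_cong) (use ev in eventually_elim, simp)
  ultimately have "(\<lambda>n. \<Sum>i<n. V (Suc i) - V i) \<longlonglongrightarrow> (\<Sum>n. V (Suc n) - V n)"
    by (simp add: summable_LIMSEQ)
  then have "(\<lambda>n. (V n - V 0) + V 0) \<longlonglongrightarrow> (\<Sum>n. V (Suc n) - V n) + V 0"
    by (intro tendsto_add) (simp_all add: sum_lessThan_telescope)
  then show ?thesis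
    by (simp add: convergent_def) blast
qed

section \<open>Coinductive expansions over a multiplicative set of frequencies\<close>

locale unit_frequencies =
  fixes W :: "complex set"
  assumes one_mem: "1 \<in> W"
    and norm_mem: "w \<in> W \<Longrightarrow> norm w = 1"
    and mult_mem: "w \<in> W \<Longrightarrow> w' \<in> W \<Longrightarrow> w * w' \<in> W"
begin

text \<open>The last rule discards the index \<open>0\<close>, where \<open>log_scale\<close> takes junk values and is not multiplicative.\<close>

inductive_set level :: "int \<Rightarrow> (nat \<Rightarrow> complex) set" for s :: int where
  monomial: "w \<in> W \<Longrightarrow> (\<lambda>n. c * w ^ n * log_scale l s n) \<in> level s"
| add: "t \<in> level s \<Longrightarrow> t' \<in> level s \<Longrightarrow> (\<lambda>n. t n + t' n) \<in> level s"
| eventually_eq: "t \<in> level s \<Longrightarrow> \<forall>\<^sub>F n in sequentially. t n = t' n \<Longrightarrow> t' \<in> level s"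

lemma level_zero: "(\<lambda>n. 0) \<in> level s"
  using level.monomial[OF one_mem, of 0] by simp

lemma level_sum:
  "(\<And>i. i \<in> I \<Longrightarrow> f i \<in> level s) \<Longrightarrow> (\<lambda>n. \<Sum>i\<in>I. f i n) \<in> level s"
  by (induction I rule: infinite_finite_induct) (auto intro: level_zero level.add)

lemma level_log_poly:
  assumes "w \<in> W"
  shows "(\<lambda>n. c * w ^ n * complex_of_real (log_poly P s (real n))) \<in> level s"
proof (rule level.eventually_eq)
  show "(\<lambda>n. \<Sum>i\<le>degree P. (c * of_real (coeff P i)) * w ^ n * log_scale i s n) \<in> level s"
    by (intro level_sum level.monomial assms)
  show "\<forall>\<^sub>F n in sequentially. (\<Sum>i\<le>degree P. (c * of_real (coeff P i)) * w ^ n * log_scale i s n)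
      = c * w ^ n * complex_of_real (log_poly P s (real n))"
    using eventually_ge_at_top[of "1::nat"]
    by eventually_elim
      (simp add: log_scale_eq_log_poly log_poly_def poly_monom poly_altdef[of P]
        sum_distrib_left sum_distrib_right algebra_simps)
qed

lemma level_growth: "t \<in> level s \<Longrightarrow> growth_order s t"
proof (induction rule: level.induct)
  case (monomial w c l)
  show ?case
    by (rule growth_order_cong[OF growth_order_log_poly[OF norm_mem[OF monomial], of s c "monom 1 l"]],
        use eventually_ge_at_top[of "1::nat"] in eventually_elim)
      (simp add: log_scale_eq_log_poly)
qed (auto intro: growth_order_add growth_order_cong)

lemma level_mult:
  assumes "w \<in> W"
  shows "t \<in> level s \<Longrightarrow> (\<lambda>n. t n * (w ^ n * log_scale l m n)) \<in> level (s + m)"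
proof (induction rule: level.induct)
  case (monomial v c k)
  show ?case
    by (rule level.eventually_eq[OF level.monomial[OF mult_mem[OF monomial assms], of c "k + l"]],
        use eventually_ge_at_top[of "1::nat"] in eventually_elim)
      (simp add: log_scale_mult[symmetric] power_mult_distrib)
next
  case (add t t')
  then show ?case using level.add by (simp add: distrib_right)
next
  case (eventually_eq t t')
  show ?case
    by (rule level.eventually_eq[OF eventually_eq.IH]) (use eventually_eq.hyps(2) in eventually_elim, simp)
qed

text \<open>The growth clause is demanded anew at every unfolding, so removing k levels leaves a
  remainder of order s + k. This is what later turns the infinite unfolding into error
  estimates.\<close>

coinductive expandable :: "int \<Rightarrow> (nat \<Rightarrow> complex) \<Rightarrow> bool" where
  "growth_order s u \<Longrightarrow> t \<in> level s \<Longrightarrow> expandable (s + 1) (\<lambda>n. u n - t n) \<Longrightarrow> expandable s u"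

text \<open>A form of coinduction in which one exhibits a single term and re-establishes the
  invariant for the difference.\<close>

lemma expandable_coinduct [consumes 1, case_names step]:
  assumes "X s u"
    and "\<And>s u. X s u \<Longrightarrow> growth_order s u \<and> (\<exists>t\<in>level s. X (s + 1) (\<lambda>n. u n - t n))"
  shows "expandable s u"
  using assms(1) by (coinduction arbitrary: s u) (use assms(2) in blast)

lemma expandable_step:
  assumes "expandable s u"
  obtains t where "t \<in> level s" "expandable (s + 1) (\<lambda>n. u n - t n)"
  using assms by cases

lemma expandable_growth: "expandable s u \<Longrightarrow> growth_order s u"
  by (auto elim: expandable.cases)

lemma expandable_cong:
  assumes "expandable s u" "\<forall>\<^sub>F n in sequentially. u n = v n"
  shows "expandable s v"
proof -
  have "\<exists>u. expandable s u \<and> (\<forall>\<^sub>F n in sequentially. u n = v n)"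
    using assms by blast
  then show ?thesis
  proof (coinduction arbitrary: s v rule: expandable_coinduct)
    case (step s v)
    then obtain u where u: "expandable s u" and ev: "\<forall>\<^sub>F n in sequentially. u n = v n" by blast
    from u obtain t where "t \<in> level s" "expandable (s + 1) (\<lambda>n. u n - t n)"
      by cases
    moreover have "\<forall>\<^sub>F n in sequentially. u n - t n = v n - t n"
      using ev by eventually_elim simp
    ultimately show ?case
      using growth_order_cong[OF expandable_growth[OF u] ev] by blast
  qed
qed

lemma expandable_zero: "expandable s (\<lambda>n. 0)"
  by (rule expandable_coinduct[of "\<lambda>_ u. u = (\<lambda>n. 0)"])
    (auto intro!: level_growth level_zero bexI[of _ "\<lambda>n. 0"])

lemma level_expandable: "t \<in> level s \<Longrightarrow> expandable s t"
  using expandable.intros[of s t t] by (simp add: level_growth expandable_zero)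

lemma expandable_add:
  assumes "expandable s u" "expandable s v"
  shows "expandable s (\<lambda>n. u n + v n)"
proof (rule expandable_coinduct)
  let ?X = "\<lambda>s f. \<exists>u v. f = (\<lambda>n. u n + v n) \<and> expandable s u \<and> expandable s v"
  show "?X s (\<lambda>n. u n + v n)" using assms by blast
  fix s f assume "?X s f"
  then obtain u v where f: "f = (\<lambda>n. u n + v n)" and uv: "expandable s u" "expandable s v" by blast
  from uv(1) obtain t where t: "t \<in> level s" "expandable (s + 1) (\<lambda>n. u n - t n)"
    by cases
  from uv(2) obtain t' where t': "t' \<in> level s" "expandable (s + 1) (\<lambda>n. v n - t' n)"
    by cases
  have "(\<lambda>n. f n - (t n + t' n)) = (\<lambda>n. (u n - t n) + (v n - t' n))"
    by (auto simp: f)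
  then have "?X (s + 1) (\<lambda>n. f n - (t n + t' n))"
    using t(2) t'(2) by (intro exI[of _ "\<lambda>n. u n - t n"] exI[of _ "\<lambda>n. v n - t' n"]) simp
  then show "growth_order s f \<and> (\<exists>t\<in>level s. ?X (s + 1) (\<lambda>n. f n - t n))"
    using growth_order_add[OF uv[THEN expandable_growth]] level.add[OF t(1) t'(1)]
    unfolding f by (intro conjI bexI[of _ "\<lambda>n. t n + t' n"])
qed

lemma expandable_pred:
  assumes "expandable (s + 1) u"
  shows "expandable s u"
  \<comment> \<open>The term removed at the additional lower level is zero.\<close>
  by (rule expandable.intros[OF growth_order_mono[OF expandable_growth[OF assms]] level_zero])
    (use assms in auto)

lemma expandable_mono:
  assumes "expandable s u" "s' \<le> s"
  shows "expandable s' u"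
  using assms(2,1) by (induction rule: int_le_induct) (use expandable_pred in auto)

lemma expandable_mult:
  assumes "w \<in> W" "expandable s u"
  shows "expandable (s + m) (\<lambda>n. u n * (w ^ n * log_scale l m n))"
proof -
  let ?e = "\<lambda>n. w ^ n * log_scale l m n"
  have e: "growth_order m ?e"
    using level_growth[OF level.monomial[OF assms(1), of 1 l m]] by simp
  \<comment> \<open>Invariant: being the product of an expandable sequence with the fixed factor.
    The factor multiplies each removed term and shifts its level by m.\<close>
  let ?X = "\<lambda>x f. \<exists>s u. x = s + m \<and> f = (\<lambda>n. u n * ?e n) \<and> expandable s u"
  show ?thesis
  proof (rule expandable_coinduct[of ?X])
    show "?X (s + m) (\<lambda>n. u n * ?e n)" using assms by blast
    fix x f assume "?X x f"
    then obtain s u where x: "x = s + m" and f: "f = (\<lambda>n. u n * ?e n)" and u: "expandable s u"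
      by blast
    from u obtain t where t: "t \<in> level s" "expandable (s + 1) (\<lambda>n. u n - t n)"
      by cases
    have "growth_order x f"
      unfolding x f by (rule growth_order_mult[OF expandable_growth[OF u] e])
    moreover have "(\<lambda>n. f n - t n * ?e n) = (\<lambda>n. (u n - t n) * ?e n)"
      by (auto simp: f algebra_simps)
    moreover have "x + 1 = (s + 1) + m" by (simp add: x)
    ultimately have "?X (x + 1) (\<lambda>n. f n - t n * ?e n)"
      using t(2) by (intro exI[of _ "s + 1"] exI[of _ "\<lambda>n. u n - t n"]) simp
    then show "growth_order x f \<and> (\<exists>t\<in>level x. ?X (x + 1) (\<lambda>n. f n - t n))"
      using \<open>growth_order x f\<close> level_mult[OF assms(1) t(1), of l m] unfolding x
      by (intro conjI bexI[of _ "\<lambda>n. t n * ?e n"])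
  qed
qed

text \<open>Removing the k-th Taylor term from the remainder after k terms leaves the remainder
  after k + 1 terms, so the family of remainders is its own coinduction invariant. Convergence of
  the Taylor series is not involved.\<close>

lemma expandable_taylor_remainder:
  assumes "w \<in> W" "k > 0"
  shows "expandable (m + int k) (\<lambda>n. c * w ^ n * complex_of_real (log_poly P m (real n + 1)
      - (\<Sum>i<k. log_poly (iter_log_poly_deriv m P i) (m + int i) (real n) / fact i)))"
    (is "expandable _ (?R k)")
proof (rule expandable_coinduct[of "\<lambda>s u. \<exists>k>0. s = m + int k \<and> u = ?R k"])
  let ?X = "\<lambda>s u. \<exists>k>0. s = m + int k \<and> u = ?R k"
  show "?X (m + int k) (?R k)" using assms(2) by blast
  fix s u assume "?X s u"
  then obtain k where k: "k > 0" and s: "s = m + int k" and u: "u = ?R k" by blast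
  let ?t = "\<lambda>n. c / fact k * w ^ n * complex_of_real (log_poly (iter_log_poly_deriv m P k) s (real n))"
  have growth: "growth_order s u"
    unfolding u s by (intro growth_order_unit_powers norm_mem assms log_poly_taylor_bigo k)
  have t: "?t \<in> level s"
    by (intro level_log_poly assms)
  have "(\<lambda>n. u n - ?t n) = ?R (Suc k)"
    by (auto simp: u s algebra_simps)
  moreover have "s + 1 = m + int (Suc k)" by (simp add: s)
  ultimately have "?X (s + 1) (\<lambda>n. u n - ?t n)" by (intro exI[of _ "Suc k"] conjI zero_less_Suc)
  with growth t show "growth_order s u \<and> (\<exists>t\<in>level s. ?X (s + 1) (\<lambda>n. u n - t n))"
    by (intro conjI bexI[of _ ?t])
qed

section \<open>Antidifferences of expandable sequences\<close>

lemma monomial_antidifference: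
  fixes c :: complex and l :: nat and s :: int
  assumes w: "w \<in> W"
  defines "t \<equiv> \<lambda>n. c * w ^ n * log_scale l (s + 1) n"
  shows "\<exists>p\<in>level s. \<exists>q\<in>level (s + 1).
    expandable (s + 2) (\<lambda>n. t n - ((p (Suc n) + q (Suc n)) - (p n + q n)))"
proof (cases "w = 1")
  case True
  \<comment> \<open>Frequency 1: with P(log x) x^(-s) a primitive of (log x)^l x^(-s-1), the
    first-order Taylor term of the difference is the given monomial. The error is the remainder
    after two terms, of order s + 2.\<close>
  obtain P where P: "log_poly_deriv s P = monom 1 l"
    using log_poly_ode_monom by blast
  let ?p = "\<lambda>n. c * 1 ^ n * complex_of_real (log_poly P s (real n))"
  have p: "?p \<in> level s" by (rule level_log_poly[OF one_mem])
  have "expandable (s + 2) (\<lambda>n. t n - ((?p (Suc n) + 0) - (?p n + 0)))"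
  proof (rule expandable_cong)
    show "expandable (s + 2) (\<lambda>n. (- c) * 1 ^ n * complex_of_real (log_poly P s (real n + 1)
      - (\<Sum>i<2. log_poly (iter_log_poly_deriv s P i) (s + int i) (real n) / fact i)))"
      using expandable_taylor_remainder[OF one_mem, of 2 s "- c" P] by simp
    show "\<forall>\<^sub>F n in sequentially. (- c) * 1 ^ n * complex_of_real (log_poly P s (real n + 1)
      - (\<Sum>i<2. log_poly (iter_log_poly_deriv s P i) (s + int i) (real n) / fact i))
      = t n - ((?p (Suc n) + 0) - (?p n + 0))"
      using eventually_ge_at_top[of "1::nat"]
      by eventually_elim
        (simp add: t_def True log_scale_eq_log_poly P numeral_2_eq_2 algebra_simps)
  qed
  then show ?thesis using p level_zero[of "s + 1"]
    by (intro bexI[of _ ?p] bexI[of _ "\<lambda>_. 0"])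
next
  case False
  \<comment> \<open>With f(n) = (log n)^l n^(-s-1), the difference of d w^n f(n) is d (w - 1) w^n
    f(n) + d w^(n+1) (f(n+1) - f(n)). The first summand is the given monomial; the second is a
    Taylor remainder after one term, of order s + 2.\<close>
  define d where "d = c / (w - 1)"
  have d: "c = d * (w - 1)" using False by (simp add: d_def)
  let ?q = "\<lambda>n. d * w ^ n * log_scale l (s + 1) n"
  let ?f = "log_poly (monom 1 l) (s + 1)"
  have q: "?q \<in> level (s + 1)" by (rule level.monomial[OF w])
  have "expandable (s + 2) (\<lambda>n. t n - ((0 + ?q (Suc n)) - (0 + ?q n)))"
  proof (rule expandable_cong)
    show "expandable (s + 2) (\<lambda>n. (- d * w) * w ^ n * complex_of_real (?f (real n + 1)
      - (\<Sum>i<1. log_poly (iter_log_poly_deriv (s + 1) (monom 1 l) i) (s + 1 + int i) (real n) / fact i)))"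
      using expandable_taylor_remainder[OF w, of 1 "s + 1" "- d * w" "monom 1 l"] by (simp add: add.assoc)
    show "\<forall>\<^sub>F n in sequentially. (- d * w) * w ^ n * complex_of_real (?f (real n + 1)
      - (\<Sum>i<1. log_poly (iter_log_poly_deriv (s + 1) (monom 1 l) i) (s + 1 + int i) (real n) / fact i))
      = t n - ((0 + ?q (Suc n)) - (0 + ?q n))"
      using eventually_ge_at_top[of "1::nat"]
      by eventually_elim
        (simp add: t_def d log_scale_eq_log_poly algebra_simps)
  qed
  then show ?thesis using q level_zero[of s]
    by (intro bexI[of _ ?q] bexI[of _ "\<lambda>_. 0"])
qed

text \<open>A level may mix frequencies: frequency 1 loses one order under summation and contributes
  to p, all others keep the order and contribute to q. Everything is additive.\<close>

lemma level_antidifference: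
  assumes "t \<in> level (s + 1)"
  shows "\<exists>p\<in>level s. \<exists>q\<in>level (s + 1).
    expandable (s + 2) (\<lambda>n. t n - ((p (Suc n) + q (Suc n)) - (p n + q n)))"
  using assms
proof (induction rule: level.induct)
  case (monomial w c l)
  then show ?case by (rule monomial_antidifference)
next
  case (add t t')
  then obtain p q p' q' where pq: "p \<in> level s" "q \<in> level (s + 1)" "p' \<in> level s" "q' \<in> level (s + 1)"
    and e: "expandable (s + 2) (\<lambda>n. t n - ((p (Suc n) + q (Suc n)) - (p n + q n)))"
      "expandable (s + 2) (\<lambda>n. t' n - ((p' (Suc n) + q' (Suc n)) - (p' n + q' n)))"
    by blast
  have "expandable (s + 2) (\<lambda>n. t n + t' n - ((p (Suc n) + p' (Suc n) + (q (Suc n) + q' (Suc n)))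
      - (p n + p' n + (q n + q' n))))"
    by (rule expandable_cong[OF expandable_add[OF e]]) (simp add: algebra_simps)
  then show ?case using level.add[OF pq(1,3)] level.add[OF pq(2,4)]
    by (intro bexI[of _ "\<lambda>n. p n + p' n"] bexI[of _ "\<lambda>n. q n + q' n"])
next
  case (eventually_eq t t')
  then obtain p q where pq: "p \<in> level s" "q \<in> level (s + 1)"
    and e: "expandable (s + 2) (\<lambda>n. t n - ((p (Suc n) + q (Suc n)) - (p n + q n)))"
    by blast
  have "expandable (s + 2) (\<lambda>n. t' n - ((p (Suc n) + q (Suc n)) - (p n + q n)))"
    by (rule expandable_cong[OF e]) (use eventually_eq.hyps(2) in eventually_elim, simp)
  then show ?case using pq by blast
qed

text \<open>Only the leading term at level s + 1 has to be summed; the rest of u is already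
  expandable of order s + 2 and joins the error.\<close>

lemma expandable_antidifference_step:
  assumes "expandable (s + 1) u"
  obtains p q where "p \<in> level s" "q \<in> level (s + 1)"
    "expandable (s + 2) (\<lambda>n. u n - ((p (Suc n) + q (Suc n)) - (p n + q n)))"
proof -
  from assms obtain t where t: "t \<in> level (s + 1)" "expandable (s + 1 + 1) (\<lambda>n. u n - t n)"
    by cases
  obtain p q where pq: "p \<in> level s" "q \<in> level (s + 1)"
    and e: "expandable (s + 2) (\<lambda>n. t n - ((p (Suc n) + q (Suc n)) - (p n + q n)))"
    using level_antidifference[OF t(1)] by blast
  from t(2) have "expandable (s + 2) (\<lambda>n. u n - t n)" by (simp add: add.assoc)
  from expandable_cong[OF expandable_add[OF this e]]
  have "expandable (s + 2) (\<lambda>n. u n - ((p (Suc n) + q (Suc n)) - (p n + q n)))"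
    by simp
  with pq that show ?thesis by blast
qed

lemma expandable_antidifference_pos:
  assumes "s \<ge> 1" "q \<in> level s" "expandable (s + 1) u"
    and "\<forall>\<^sub>F n in sequentially. (U (Suc n) - q (Suc n)) - (U n - q n) = u n"
    and "(\<lambda>n. U n - q n) \<longlonglongrightarrow> 0"
  shows "expandable s U"
proof -
  \<comment> \<open>The invariant carries a pending correction q at level s, the part of the
    previous antidifference that lies one level higher than p. Once q is subtracted, U is a null
    sequence with expandable differences of order s + 1.\<close>
  define X where "X = (\<lambda>s U. s \<ge> 1 \<and> (\<exists>q\<in>level s. \<exists>u. expandable (s + 1) u \<and>
    (\<forall>\<^sub>F n in sequentially. (U (Suc n) - q (Suc n)) - (U n - q n) = u n) \<and>
    (\<lambda>n. U n - q n) \<longlonglongrightarrow> 0))"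
  have XI: "X s U" if "s \<ge> 1" "q \<in> level s" "expandable (s + 1) u"
    "\<forall>\<^sub>F n in sequentially. (U (Suc n) - q (Suc n)) - (U n - q n) = u n"
    "(\<lambda>n. U n - q n) \<longlonglongrightarrow> 0" for s q u U
    using that unfolding X_def by blast
  show ?thesis
  proof (rule expandable_coinduct[of X])
    show "X s U" by (rule XI[OF assms])
    fix s U assume "X s U"
    then obtain q u where s: "s \<ge> 1" and q: "q \<in> level s" and u: "expandable (s + 1) u"
      and ev: "\<forall>\<^sub>F n in sequentially. (U (Suc n) - q (Suc n)) - (U n - q n) = u n"
      and lim: "(\<lambda>n. U n - q n) \<longlonglongrightarrow> 0"
      unfolding X_def by blast
    have "growth_order s (\<lambda>n. (U n - q n) + q n)"
      using level_growth[OF q]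
        growth_order_antidifference[OF lim expandable_growth[OF u] s ev]
      by (intro growth_order_add)
    then have growth: "growth_order s U" by simp
    obtain p q' where p: "p \<in> level s" and q': "q' \<in> level (s + 1)"
      and e: "expandable (s + 2) (\<lambda>n. u n - ((p (Suc n) + q' (Suc n)) - (p n + q' n)))"
      using expandable_antidifference_step[OF u] by blast
    \<comment> \<open>The term removed at level s joins the pending q with the new p; q' becomes the
      pending correction at level s + 1.\<close>
    have t: "(\<lambda>n. q n + p n) \<in> level s" by (rule level.add[OF q p])
    have "X (s + 1) (\<lambda>n. U n - (q n + p n))"
    proof (rule XI[OF _ q'])
      show "s + 1 \<ge> 1" using s by simp
      show "expandable (s + 1 + 1) (\<lambda>n. u n - ((p (Suc n) + q' (Suc n)) - (p n + q' n)))"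
        using e by (simp add: add.assoc)
      show "\<forall>\<^sub>F n in sequentially. (U (Suc n) - (q (Suc n) + p (Suc n)) - q' (Suc n))
          - (U n - (q n + p n) - q' n) = u n - ((p (Suc n) + q' (Suc n)) - (p n + q' n))"
        using ev by eventually_elim (simp add: algebra_simps)
      \<comment> \<open>As s \<ge> 1, terms of these levels tend to 0, so the limit condition
        survives the step.\<close>
      have "p \<longlonglongrightarrow> 0" "q' \<longlonglongrightarrow> 0"
        using growth_order_tendsto_zero[OF level_growth[OF p] s]
          growth_order_tendsto_zero[OF level_growth[OF q']] s by auto
      then have "(\<lambda>n. (U n - q n) - p n - q' n) \<longlonglongrightarrow> 0 - 0 - 0"
        by (intro tendsto_diff lim)
      then show "(\<lambda>n. U n - (q n + p n) - q' n) \<longlonglongrightarrow> 0"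
        by (simp add: algebra_simps)
    qed
    then show "growth_order s U \<and> (\<exists>t\<in>level s. X (s + 1) (\<lambda>n. U n - t n))"
      using growth t by (intro conjI bexI[of _ "\<lambda>n. q n + p n"])
  qed
qed

lemma const_level_zero: "(\<lambda>n. c) \<in> level 0"
  using level.monomial[OF one_mem, of c 0 0] by (simp add: log_scale_def)

lemma expandable_add_level:
  assumes "t \<in> level s" "expandable (s + 1) (\<lambda>n. u n - t n)"
  shows "expandable s u"
  using expandable_add[OF level_expandable[OF assms(1)] expandable_pred[OF assms(2)]] by simp

text \<open>Levels are removed from -k up to 0. Growth of U needs no separate estimate here: U is a
  term of level -k plus a sequence already known to be expandable of higher order.\<close>

lemma expandable_antidifference_nonpos:
  assumes "q \<in> level (- int k)" "expandable (- int k + 1) u"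
    and "\<forall>\<^sub>F n in sequentially. (U (Suc n) - q (Suc n)) - (U n - q n) = u n"
  shows "expandable (- int k) U"
  using assms
proof (induction k arbitrary: q u U)
  case 0
  then have u: "expandable (0 + 1) u" and q: "q \<in> level 0"
    and ev: "\<forall>\<^sub>F n in sequentially. (U (Suc n) - q (Suc n)) - (U n - q n) = u n" by simp_all
  obtain p q' where p: "p \<in> level 0" and q': "q' \<in> level (0 + 1)"
    and e: "expandable (0 + 2) (\<lambda>n. u n - ((p (Suc n) + q' (Suc n)) - (p n + q' n)))"
    using expandable_antidifference_step[OF u] by blast
  let ?V = "\<lambda>n. U n - (q n + p n) - q' n"
  have evV: "\<forall>\<^sub>F n in sequentially. ?V (Suc n) - ?V n = u n - ((p (Suc n) + q' (Suc n)) - (p n + q' n))"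
    using ev by eventually_elim (simp add: algebra_simps)
  \<comment> \<open>After the corrections at levels 0 and 1 the differences have order 2. The limit
    c is the constant of summation; absorbing it at level 0 yields the null sequence required in
    positive order.\<close>
  have "convergent ?V"
    by (rule growth_order_antidifference_convergent[OF _ evV])
      (use expandable_growth[OF e] in simp)
  then obtain c where c: "?V \<longlonglongrightarrow> c" by (auto simp: convergent_def)
  let ?t = "\<lambda>n. q n + p n + c"
  have t: "?t \<in> level 0" by (intro level.add q p const_level_zero)
  have "expandable 1 (\<lambda>n. U n - ?t n)"
  proof (rule expandable_antidifference_pos[of 1 q'])
    show "q' \<in> level 1" using q' by simp
    show "expandable (1 + 1) (\<lambda>n. u n - ((p (Suc n) + q' (Suc n)) - (p n + q' n)))"
      using e by simp
    show "\<forall>\<^sub>F n in sequentially. (U (Suc n) - ?t (Suc n) - q' (Suc n)) - (U n - ?t n - q' n)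
        = u n - ((p (Suc n) + q' (Suc n)) - (p n + q' n))"
      using evV by eventually_elim (simp add: algebra_simps)
    have "(\<lambda>n. ?V n - c) \<longlonglongrightarrow> c - c" by (intro tendsto_diff c tendsto_const)
    then show "(\<lambda>n. U n - ?t n - q' n) \<longlonglongrightarrow> 0" by (simp add: algebra_simps)
  qed simp
  then show ?case using expandable_add_level[OF t] by simp
next
  case (Suc k)
  let ?s = "- int (Suc k)"
  have eqs: "?s + 1 = - int k" "?s + 2 = - int k + 1" by simp_all
  obtain p q' where p: "p \<in> level ?s" and q': "q' \<in> level (- int k)"
    and e: "expandable (- int k + 1) (\<lambda>n. u n - ((p (Suc n) + q' (Suc n)) - (p n + q' n)))"
    using expandable_antidifference_step[OF Suc.prems(2)] unfolding eqs by blast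
  have t: "(\<lambda>n. q n + p n) \<in> level ?s" by (rule level.add[OF Suc.prems(1) p])
  have "expandable (- int k) (\<lambda>n. U n - (q n + p n))"
  proof (rule Suc.IH[OF q' e])
    show "\<forall>\<^sub>F n in sequentially. (U (Suc n) - (q (Suc n) + p (Suc n)) - q' (Suc n))
        - (U n - (q n + p n) - q' n) = u n - ((p (Suc n) + q' (Suc n)) - (p n + q' n))"
      using Suc.prems(3) by eventually_elim (simp add: algebra_simps)
  qed
  then show ?case using expandable_add_level[OF t] unfolding eqs by blast
qed

lemma expandable_antidifference:
  assumes "expandable s u" "\<forall>\<^sub>F n in sequentially. U (Suc n) - U n = u n"
  shows "\<exists>s. expandable s U"
proof -
  \<comment> \<open>The order is lowered to 1 - k with k natural, where the previous lemma applies
    with zero pending correction.\<close>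
  have "expandable (- int (nat (1 - s)) + 1) u"
    by (rule expandable_mono[OF assms(1)]) linarith
  from expandable_antidifference_nonpos[OF level_zero this, of U] assms(2) show ?thesis
    by auto
qed

end

section \<open>Extracting the coefficients\<close>

lemma generated_algebra_zero: "(\<lambda>n. 0) \<in> generated_algebra G"
  using generated_algebra.scale[OF generated_algebra.one, of 0] by simp

text \<open>Membership is tested on the power sequence, so that closure under products follows
  directly from multiplication in the algebra.\<close>

definition algebra_frequencies :: "(nat \<Rightarrow> complex) set \<Rightarrow> complex set" where
  "algebra_frequencies G = {w. norm w = 1 \<and> (\<lambda>n. w ^ n) \<in> generated_algebra G}"

interpretation algebra_frequencies: unit_frequencies "algebra_frequencies G" for G
proof
  show "1 \<in> algebra_frequencies G"
    using generated_algebra.one[of G] by (simp add: algebra_frequencies_def power_one[abs_def])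
  show "w * w' \<in> algebra_frequencies G"
    if "w \<in> algebra_frequencies G" "w' \<in> algebra_frequencies G" for w w'
    using that generated_algebra.mult[of "\<lambda>n. w ^ n" G "\<lambda>n. w' ^ n"]
    by (simp add: algebra_frequencies_def norm_mult power_mult_distrib[symmetric])
qed (simp add: algebra_frequencies_def)

text \<open>Monomials with the same power of the logarithm merge into one coefficient. Beyond K the
  coefficients are zero as functions, because the support looks at every n \<ge> 1 whereas the
  identity for t holds only eventually.\<close>

lemma level_coefficients:
  assumes "t \<in> algebra_frequencies.level G m"
  shows "\<exists>b K. (\<forall>l. b l \<in> generated_algebra G) \<and> (\<forall>l\<ge>K. b l = (\<lambda>n. 0)) \<and>
    (\<forall>\<^sub>F n in sequentially. t n = (\<Sum>l<K. b l n * log_scale l m n))"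
  using assms
proof (induction rule: algebra_frequencies.level.induct)
  case (monomial w c l)
  let ?b = "\<lambda>l'. if l' = l then (\<lambda>n. c * w ^ n) else (\<lambda>n. 0)"
  have "(\<lambda>n. c * w ^ n) \<in> generated_algebra G"
    using monomial by (auto simp: algebra_frequencies_def intro: generated_algebra.scale)
  moreover have "(\<Sum>l'<Suc l. ?b l' n * log_scale l' m n) = c * w ^ n * log_scale l m n" for n
    by (subst sum.mono_neutral_right[of _ "{l}"]) auto
  ultimately show ?case
    by (intro exI[of _ ?b] exI[of _ "Suc l"]) (auto simp: generated_algebra_zero simp del: sum.lessThan_Suc)
next
  case (add t t')
  then obtain b K b' K' where
    b: "\<forall>l. b l \<in> generated_algebra G" "\<forall>l\<ge>K. b l = (\<lambda>n. 0)"
      "\<forall>\<^sub>F n in sequentially. t n = (\<Sum>l<K. b l n * log_scale l m n)" and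
    b': "\<forall>l. b' l \<in> generated_algebra G" "\<forall>l\<ge>K'. b' l = (\<lambda>n. 0)"
      "\<forall>\<^sub>F n in sequentially. t' n = (\<Sum>l<K'. b' l n * log_scale l m n)"
    by blast
  let ?K = "max K K'"
  have K: "(\<Sum>l<K. b l n * log_scale l m n) = (\<Sum>l<?K. b l n * log_scale l m n)" for n
    using b(2) by (intro sum.mono_neutral_left) auto
  have K': "(\<Sum>l<K'. b' l n * log_scale l m n) = (\<Sum>l<?K. b' l n * log_scale l m n)" for n
    using b'(2) by (intro sum.mono_neutral_left) auto
  have "\<forall>\<^sub>F n in sequentially. t n + t' n = (\<Sum>l<?K. (b l n + b' l n) * log_scale l m n)"
    using b(3) b'(3) by eventually_elim (simp only: K K' sum.distrib distrib_right)
  then show ?case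
    using b(1,2) b'(1,2)
    by (intro exI[of _ "\<lambda>l n. b l n + b' l n"] exI[of _ ?K]) (auto intro: generated_algebra.add)
next
  case (eventually_eq t t')
  then obtain b K where
    b: "\<forall>l. b l \<in> generated_algebra G" "\<forall>l\<ge>K. b l = (\<lambda>n. 0)"
      "\<forall>\<^sub>F n in sequentially. t n = (\<Sum>l<K. b l n * log_scale l m n)"
    by blast
  have "\<forall>\<^sub>F n in sequentially. t' n = (\<Sum>l<K. b l n * log_scale l m n)"
    using b(3) eventually_eq.hyps(2) by eventually_elim simp
  then show ?case using b by blast
qed

lemma expandable_terms:
  assumes "algebra_frequencies.expandable G s u"
  obtains t where "\<And>i. t i \<in> algebra_frequencies.level G (s + int i)"
    "\<And>k. growth_order (s + int k) (\<lambda>n. u n - (\<Sum>i<k. t i n))"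
proof -
  \<comment> \<open>Each unfolding only asserts existence, so the remainders are fixed by dependent
    choice, with the clause for k = 0 anchoring them at u. The terms are differences of consecutive
    remainders and their sum telescopes.\<close>
  let ?P = "\<lambda>k U. algebra_frequencies.expandable G (s + int k) U \<and> (k = 0 \<longrightarrow> U = u)"
  let ?Q = "\<lambda>k U U'. (\<lambda>n. U n - U' n) \<in> algebra_frequencies.level G (s + int k)"
  have "\<exists>U. \<forall>k. ?P k (U k) \<and> ?Q k (U k) (U (Suc k))"
  proof (rule dependent_nat_choice)
    show "\<exists>U. ?P 0 U" using assms by auto
    fix U k assume "?P k U"
    then have "algebra_frequencies.expandable G (s + int k) U" by simp
    then obtain t where "t \<in> algebra_frequencies.level G (s + int k)"
      "algebra_frequencies.expandable G (s + int k + 1) (\<lambda>n. U n - t n)"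
      by (rule algebra_frequencies.expandable_step)
    then show "\<exists>U'. ?P (Suc k) U' \<and> ?Q k U U'"
      by (intro exI[of _ "\<lambda>n. U n - t n"]) (simp add: algebra_simps)
  qed
  then obtain U where U: "\<And>k. ?P k (U k)" "\<And>k. ?Q k (U k) (U (Suc k))" by blast
  let ?t = "\<lambda>i n. U i n - U (Suc i) n"
  have "u n - (\<Sum>i<k. ?t i n) = U k n" for n k
    using U(1)[of 0] by (induction k) (auto simp: algebra_simps)
  then show ?thesis
    using U algebra_frequencies.expandable_growth[of G]
    by (intro that[of ?t]) auto
qed

text \<open>One spare order outweighs the loss: with e = 1/2 the sequence is O(n^(-A-1/2)).\<close>

lemma growth_order_smallo:
  assumes "growth_order (A + 1) u"
  shows "u \<in> o(\<lambda>n. of_nat n powi (- A))"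
proof -
  have "(\<lambda>n. norm (u n)) \<in> O(\<lambda>n. real n powr (1 / 2 - of_int (A + 1)))"
    using assms unfolding growth_order_def by (elim allE[of _ "1 / 2"]) simp
  also have "(\<lambda>n. real n powr (1 / 2 - of_int (A + 1))) \<in> o(\<lambda>n. real n powr (- of_int A))"
    by (subst powr_smallo_iff[OF filterlim_real_sequentially]) auto
  also have "(\<lambda>n. real n powr (- of_int A)) \<in> \<Theta>(\<lambda>n. norm (of_nat n powi (- A) :: complex))"
  proof (rule bigthetaI_cong)
    show "\<forall>\<^sub>F n in sequentially. real n powr (- of_int A) = norm (of_nat n powi (- A) :: complex)"
      using eventually_ge_at_top[of "1::nat"]
    proof eventually_elim
      case (elim n)
      then show ?case
        using powr_real_of_int'[of "real n" "- A"] by (simp add: norm_power_int)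
    qed
  qed
  finally show ?thesis by simp
qed

lemma expandable_has_asymptotic_expansion:
  assumes "algebra_frequencies.expandable G s u"
  shows "has_asymptotic_expansion (generated_algebra G) u"
proof -
  obtain t where t: "\<And>i. t i \<in> algebra_frequencies.level G (s + int i)"
    "\<And>k. growth_order (s + int k) (\<lambda>n. u n - (\<Sum>i<k. t i n))"
    using expandable_terms[OF assms] by blast
  have "\<forall>i. \<exists>b K. (\<forall>l. b l \<in> generated_algebra G) \<and> (\<forall>l\<ge>K. b l = (\<lambda>n. 0)) \<and>
    (\<forall>\<^sub>F n in sequentially. t i n = (\<Sum>l<K. b l n * log_scale l (s + int i) n))"
    using level_coefficients[OF t(1)] by blast
  from choice[OF this] obtain b where "\<forall>i. \<exists>K. (\<forall>l. b i l \<in> generated_algebra G) \<and> (\<forall>l\<ge>K. b i l = (\<lambda>n. 0)) \<and>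
    (\<forall>\<^sub>F n in sequentially. t i n = (\<Sum>l<K. b i l n * log_scale l (s + int i) n))" ..
  from choice[OF this] obtain K where b: "\<And>i l. b i l \<in> generated_algebra G" "\<And>i l. l \<ge> K i \<Longrightarrow> b i l = (\<lambda>n. 0)"
    "\<And>i. \<forall>\<^sub>F n in sequentially. t i n = (\<Sum>l<K i. b i l n * log_scale l (s + int i) n)"
    by auto
  \<comment> \<open>Reindexing by m = s + i; below level s the coefficients are zero.\<close>
  define a where "a = (\<lambda>l m. if m < s then (\<lambda>n. 0) else b (nat (m - s)) l)"
  have a_eq: "a l (s + int i) = b i l" for l i by (simp add: a_def)
  have a_mem: "\<forall>l m. a l m \<in> generated_algebra G"
    by (simp add: a_def b(1) generated_algebra_zero)
  have supp_ge: "\<forall>m<s. \<forall>l. (l, m) \<notin> coeff_support a"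
    by (simp add: a_def coeff_support_def)
  have supp: "l < K (nat (m - s))" if "(l, m) \<in> coeff_support a" for l m
    using that b(2)[of "nat (m - s)" l] by (fastforce simp: a_def coeff_support_def split: if_splits)
  then have supp_fin: "\<forall>m. finite {l. (l, m) \<in> coeff_support a}"
    by (metis (mono_tags, lifting) finite_nat_set_iff_bounded mem_Collect_eq)
  have "(\<lambda>n. u n - (\<Sum>(l, m) \<in> {(l, m) \<in> coeff_support a. m \<le> A}. a l m n * log_scale l m n))
      \<in> o(\<lambda>n. of_nat n powi (- A))" (is "?R \<in> _") for A :: int
  proof -
    \<comment> \<open>The number of levels from s to A, which is 0 if A < s; in either case s + k
      \<ge> A + 1.\<close>
    define k where "k = nat (A + 1 - s)"
    let ?S = "{(l, m) \<in> coeff_support a. m \<le> A}"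
    let ?T = "SIGMA i:{..<k}. {..<K i}"
    let ?h = "\<lambda>(i, l). (l, s + int i)"
    have inj: "inj_on ?h ?T" by (auto simp: inj_on_def)
    have sub: "?S \<subseteq> ?h ` ?T"
    proof
      fix x assume "x \<in> ?S"
      then obtain l m where x: "x = (l, m)" "(l, m) \<in> coeff_support a" "m \<le> A" by blast
      then have "m \<ge> s" using supp_ge not_less by blast
      then have "?h (nat (m - s), l) = x" "(nat (m - s), l) \<in> ?T"
        using x supp by (auto simp: k_def)
      then show "x \<in> ?h ` ?T" by force
    qed
    have sum_eq: "(\<Sum>(l, m) \<in> ?S. a l m n * log_scale l m n)
        = (\<Sum>i<k. \<Sum>l<K i. b i l n * log_scale l (s + int i) n)" if "n \<ge> 1" for n
    proof -
      \<comment> \<open>The support is enlarged to all indices occurring in the first k levels. A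
        coefficient outside the support vanishes only at n \<ge> 1, hence the restriction on
        n.\<close>
      have "(\<Sum>(l, m) \<in> ?S. a l m n * log_scale l m n)
          = (\<Sum>(l, m) \<in> ?h ` ?T. a l m n * log_scale l m n)"
      proof (rule sum.mono_neutral_left[OF _ sub])
        show "\<forall>x\<in>?h ` ?T - ?S. (case x of (l, m) \<Rightarrow> a l m n * log_scale l m n) = 0"
          using that by (auto simp: coeff_support_def k_def)
      qed auto
      also have "\<dots> = (\<Sum>(i, l) \<in> ?T. b i l n * log_scale l (s + int i) n)"
        by (subst sum.reindex[OF inj]) (simp add: case_prod_unfold a_eq)
      also have "\<dots> = (\<Sum>i<k. \<Sum>l<K i. b i l n * log_scale l (s + int i) n)"
        by (subst sum.Sigma) auto
      finally show ?thesis .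
    qed
    have "\<forall>\<^sub>F n in sequentially. \<forall>i\<in>{..<k}. t i n = (\<Sum>l<K i. b i l n * log_scale l (s + int i) n)"
      by (intro eventually_ball_finite ballI b(3)) simp
    then have "\<forall>\<^sub>F n in sequentially. u n - (\<Sum>i<k. t i n) = ?R n"
      using eventually_ge_at_top[of "1::nat"]
      by eventually_elim (simp add: sum_eq)
    then have "growth_order (s + int k) ?R"
      by (rule growth_order_cong[OF t(2)])
    then have "growth_order (A + 1) ?R"
      by (rule growth_order_mono) (simp add: k_def)
    then show ?thesis by (rule growth_order_smallo)
  qed
  then show ?thesis
    unfolding has_asymptotic_expansion_def using a_mem supp_ge supp_fin by blast
qed

section \<open>Nested sums\<close>

lemma decreasing_tuples_0: "decreasing_tuples 0 n = {\<lambda>_. undefined}"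
  by (simp add: decreasing_tuples_def)

lemma nested_sum_0: "nested_sum 0 z a k n = 1"
  by (simp add: nested_sum_def decreasing_tuples_0)

text \<open>Only neighbouring entries are compared in the definition; chaining these comparisons
  bounds every later entry by the first.\<close>

lemma decreasing_tuples_less_head:
  assumes "\<nu> \<in> decreasing_tuples (Suc r) n"
  shows "i \<in> {1..r} \<Longrightarrow> \<nu> (Suc i) < \<nu> 1"
proof (induction i)
  case (Suc i)
  have "\<nu> (Suc (Suc i)) < \<nu> (Suc i)"
    using assms Suc.prems by (auto simp: decreasing_tuples_def)
  also have "\<nu> (Suc i) \<le> \<nu> 1"
    using Suc by (cases "i = 0") auto
  finally show ?case .
qed simp

text \<open>The restriction keeps the result extensional, which makes prepending an entry and
  dropping it mutually inverse on decreasing tuples.\<close>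

definition tuple_cons :: "nat \<Rightarrow> nat \<Rightarrow> (nat \<Rightarrow> nat) \<Rightarrow> nat \<Rightarrow> nat" where
  "tuple_cons r m \<nu> = (\<lambda>i\<in>{1..Suc r}. if i = 1 then m else \<nu> (i - 1))"

lemma tuple_cons_mem:
  assumes "m \<in> {0<..<n}" "\<nu> \<in> decreasing_tuples r m"
  shows "tuple_cons r m \<nu> \<in> decreasing_tuples (Suc r) n"
proof -
  have \<nu>: "\<nu> i \<in> {0<..<m}" if "i \<in> {1..r}" for i
    using assms(2) that by (auto simp: decreasing_tuples_def PiE_iff)
  have dec: "\<nu> (Suc i) < \<nu> i" if "i \<in> {1..<r}" for i
    using assms(2) that by (auto simp: decreasing_tuples_def)
  have "tuple_cons r m \<nu> i \<in> {0<..<n}" if "i \<in> {1..Suc r}" for i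
  proof (cases "i = 1")
    case True
    then show ?thesis using assms(1) by (simp add: tuple_cons_def)
  next
    case False
    then have "i - 1 \<in> {1..r}" using that by auto
    from \<nu>[OF this] show ?thesis
      using assms(1) that False by (auto simp: tuple_cons_def)
  qed
  moreover have "tuple_cons r m \<nu> (Suc i) < tuple_cons r m \<nu> i" if "i \<in> {1..<Suc r}" for i
  proof (cases "i = 1")
    case True
    then show ?thesis using \<nu>[of i] that by (simp add: tuple_cons_def)
  next
    case False
    then have "i - 1 \<in> {1..<r}" using that by auto
    from dec[OF this] show ?thesis
      using that False by (auto simp: tuple_cons_def)
  qed
  ultimately show ?thesis
    by (auto simp: decreasing_tuples_def PiE_iff tuple_cons_def extensional_def)
qed

lemma tuple_tail_mem:
  assumes "\<nu> \<in> decreasing_tuples (Suc r) n"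
  shows "(\<lambda>i\<in>{1..r}. \<nu> (Suc i)) \<in> decreasing_tuples r (\<nu> 1)"
proof -
  have "\<nu> (Suc i) \<in> {0<..<\<nu> 1}" if "i \<in> {1..r}" for i
    using assms decreasing_tuples_less_head[OF assms that] that
    by (auto simp: decreasing_tuples_def PiE_iff)
  then show ?thesis
    using assms by (auto simp: decreasing_tuples_def)
qed

lemma tuple_cons_tail:
  assumes "\<nu> \<in> decreasing_tuples (Suc r) n"
  shows "tuple_cons r (\<nu> 1) (\<lambda>i\<in>{1..r}. \<nu> (Suc i)) = \<nu>"
proof
  fix i
  show "tuple_cons r (\<nu> 1) (\<lambda>i\<in>{1..r}. \<nu> (Suc i)) i = \<nu> i"
    using assms by (cases i) (auto simp: tuple_cons_def decreasing_tuples_def PiE_iff extensional_def)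
qed

lemma tuple_tail_cons:
  assumes "\<nu> \<in> decreasing_tuples r m"
  shows "(\<lambda>i\<in>{1..r}. tuple_cons r m \<nu> (Suc i)) = \<nu>"
proof
  fix i
  show "(\<lambda>i\<in>{1..r}. tuple_cons r m \<nu> (Suc i)) i = \<nu> i"
    using assms by (auto simp: tuple_cons_def decreasing_tuples_def PiE_iff extensional_def)
qed

lemma finite_decreasing_tuples: "finite (decreasing_tuples r n)"
  unfolding decreasing_tuples_def by (intro finite_subset[OF Collect_subset] finite_PiE) auto

text \<open>The outermost, largest summation index m is split off; the remaining indices form a
  decreasing tuple below m, with parameters shifted by one.\<close>

lemma nested_sum_Suc:
  "nested_sum (Suc r) z a k n = (\<Sum>m\<in>{0<..<n}.
    nested_sum r (\<lambda>i. z (Suc i)) (\<lambda>i. a (Suc i)) (\<lambda>i. k (Suc i)) m * (z 1 ^ m * log_scale (k 1) (a 1) m))"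
proof -
  define F where "F = (\<lambda>i m. z i ^ m * of_real (ln (real m)) ^ k i / of_nat m powi a i)"
  have F1: "F 1 m = z 1 ^ m * log_scale (k 1) (a 1) m" for m
    by (simp add: F_def log_scale_def power_int_minus divide_inverse)
  have "nested_sum (Suc r) z a k n = (\<Sum>\<nu>\<in>decreasing_tuples (Suc r) n. \<Prod>i=1..Suc r. F i (\<nu> i))"
    by (simp only: nested_sum_def F_def)
  also have "\<dots> = (\<Sum>(m, \<nu>)\<in>(SIGMA m:{0<..<n}. decreasing_tuples r m).
      (\<Prod>i=1..r. F (Suc i) (\<nu> i)) * F 1 m)"
  proof (rule sum.reindex_bij_witness[of _ "\<lambda>(m, \<nu>). tuple_cons r m \<nu>"
        "\<lambda>\<nu>. (\<nu> 1, \<lambda>i\<in>{1..r}. \<nu> (Suc i))"])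
    fix \<nu> assume \<nu>: "\<nu> \<in> decreasing_tuples (Suc r) n"
    show "(case (\<nu> 1, \<lambda>i\<in>{1..r}. \<nu> (Suc i)) of (m, \<nu>) \<Rightarrow> tuple_cons r m \<nu>) = \<nu>"
      using tuple_cons_tail[OF \<nu>] by simp
    have "\<nu> 1 \<in> {0<..<n}"
      using \<nu> by (auto simp: decreasing_tuples_def PiE_iff)
    then show "(\<nu> 1, \<lambda>i\<in>{1..r}. \<nu> (Suc i)) \<in> (SIGMA m:{0<..<n}. decreasing_tuples r m)"
      using tuple_tail_mem[OF \<nu>] by blast
    have "(\<Prod>i=1..Suc r. F i (\<nu> i)) = F 1 (\<nu> 1) * (\<Prod>i=Suc 1..Suc r. F i (\<nu> i))"
      by (rule prod.atLeast_Suc_atMost) simp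
    also have "(\<Prod>i=Suc 1..Suc r. F i (\<nu> i)) = (\<Prod>i=1..r. F (Suc i) (\<nu> (Suc i)))"
      by (rule prod.shift_bounds_cl_Suc_ivl)
    finally show "(case (\<nu> 1, \<lambda>i\<in>{1..r}. \<nu> (Suc i)) of
        (m, \<nu>) \<Rightarrow> (\<Prod>i=1..r. F (Suc i) (\<nu> i)) * F 1 m) = (\<Prod>i=1..Suc r. F i (\<nu> i))"
      by simp
  next
    fix x assume "x \<in> (SIGMA m:{0<..<n}. decreasing_tuples r m)"
    then obtain m \<nu> where x: "x = (m, \<nu>)" "m \<in> {0<..<n}" "\<nu> \<in> decreasing_tuples r m" by blast
    have "tuple_cons r m \<nu> 1 = m" by (simp add: tuple_cons_def)
    then show "((case x of (m, \<nu>) \<Rightarrow> tuple_cons r m \<nu>) 1, \<lambda>i\<in>{1..r}. (case x of (m, \<nu>) \<Rightarrow> tuple_cons r m \<nu>) (Suc i)) = x"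
      using tuple_tail_cons[OF x(3)] by (simp add: x(1))
    show "(case x of (m, \<nu>) \<Rightarrow> tuple_cons r m \<nu>) \<in> decreasing_tuples (Suc r) n"
      using tuple_cons_mem[OF x(2,3)] by (simp add: x(1))
  qed
  also have "\<dots> = (\<Sum>m\<in>{0<..<n}. \<Sum>\<nu>\<in>decreasing_tuples r m. (\<Prod>i=1..r. F (Suc i) (\<nu> i)) * F 1 m)"
    by (subst sum.Sigma) (auto simp: finite_decreasing_tuples)
  also have "\<dots> = (\<Sum>m\<in>{0<..<n}. (\<Sum>\<nu>\<in>decreasing_tuples r m. \<Prod>i=1..r. F (Suc i) (\<nu> i)) * F 1 m)"
    by (simp only: sum_distrib_right)
  finally show ?thesis
    unfolding F1 by (simp only: nested_sum_def F_def)
qed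

lemma nested_sum_expandable:
  assumes "\<forall>i\<in>{1..r}. z i \<in> algebra_frequencies G"
  shows "\<exists>s. algebra_frequencies.expandable G s (nested_sum r z a k)"
  using assms
proof (induction r arbitrary: z a k)
  case 0
  \<comment> \<open>At depth 0 there is one empty tuple with empty product, so the induction starts
    from the constant 1 at level 0.\<close>
  have "nested_sum 0 z a k = (\<lambda>n. 1)" by (simp add: nested_sum_0 fun_eq_iff)
  then show ?case
    using algebra_frequencies.level_expandable[OF algebra_frequencies.const_level_zero, of G 1] by auto
next
  case (Suc r)
  let ?N = "nested_sum r (\<lambda>i. z (Suc i)) (\<lambda>i. a (Suc i)) (\<lambda>i. k (Suc i))"
  have "\<forall>i\<in>{1..r}. z (Suc i) \<in> algebra_frequencies G" using Suc.prems by simp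
  then obtain s where s: "algebra_frequencies.expandable G s ?N"
    using Suc.IH[of "\<lambda>i. z (Suc i)" "\<lambda>i. a (Suc i)" "\<lambda>i. k (Suc i)"] by blast
  have "z 1 \<in> algebra_frequencies G" using Suc.prems by simp
  then have e: "algebra_frequencies.expandable G (s + a 1)
      (\<lambda>m. ?N m * (z 1 ^ m * log_scale (k 1) (a 1) m))"
    by (rule algebra_frequencies.expandable_mult[OF _ s])
  show ?case
  proof (rule algebra_frequencies.expandable_antidifference[OF e])
    show "\<forall>\<^sub>F n in sequentially. nested_sum (Suc r) z a k (Suc n) - nested_sum (Suc r) z a k n
        = ?N n * (z 1 ^ n * log_scale (k 1) (a 1) n)"
      using eventually_ge_at_top[of "1::nat"]
    proof eventually_elim
      case (elim n)
      \<comment> \<open>Raising the bound from n to n + 1 adds exactly the summand m = n, so the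
        outer sum is an antidifference of its summand. At n = 0 this fails because indices are
        positive.\<close>
      then have "{0<..<Suc n} = insert n {0<..<n}" by auto
      then show ?case by (simp add: nested_sum_Suc)
    qed
  qed
qed

theorem theorem4:
  fixes r :: nat and z :: "nat \<Rightarrow> complex" and a :: "nat \<Rightarrow> int" and k :: "nat \<Rightarrow> nat"
  assumes "r \<ge> 1"
    and "\<forall>i\<in>{1..r}. \<exists>N>0. z i ^ N = 1"
  shows "has_asymptotic_expansion (coeff_algebra r z) (nested_sum r z a k)"
proof -
  let ?G = "(\<lambda>i n. z i ^ n) ` {1..r}"
  have "z i \<in> algebra_frequencies ?G" if i: "i \<in> {1..r}" for i
  proof -
    obtain N where "N > 0" "z i ^ N = 1" using assms(2) i by blast
    then have "norm (z i) = 1"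
      using power_eq_1_iff by blast
    then show ?thesis
      using i by (auto simp: algebra_frequencies_def intro: generated_algebra.gen)
  qed
  then obtain s where "algebra_frequencies.expandable ?G s (nested_sum r z a k)"
    using nested_sum_expandable by blast
  then show ?thesis
    unfolding coeff_algebra_def by (rule expandable_has_asymptotic_expansion)
qed

end
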